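(* For $\gamma\in\mathbb R$ let $\Lambda:\mathcal M_2\to\mathcal M_2$ be the linear map $$\Lambda(X)=X+\gamma\,D_{\sigma_1}(X)-\gamma\,D_{\sigma_2}(X)+\tfrac12 D_{\sigma_3}(X),\qquad D_{\sigma}(X)=\sigma X\sigma-\tfrac12\sigma\sigma X-\tfrac12X\sigma\sigma ,$$ where $\sigma_1,\sigma_2,\sigma_3$ are the Pauli matrices; equivalently, $$\Lambda\begin{bmatrix} r_{11}&r_{12}\\ r_{21}&r_{22}\end{bmatrix}=\begin{bmatrix} r_{11}&2\gamma r_{21}\\ 2\gamma r_{12}&r_{22}\end{bmatrix}.$$ Then for $\gamma=\tfrac12$ the map $\Lambda$ is the transposition map; $\Lambda$ is positive for $-\tfrac12\le\gamma\le\tfrac12$; and $\Lambda$ is not completely positive for any $\gamma\in\mathbb R$. Therefore $\Lambda$, for $-\tfrac12\le\gamma\le\tfrac12$, is a one-parameter family of positive but not completely positive maps.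
   Context: $\mathcal M_2$ is the algebra of $2\times2$ complex matrices. A linear map on a matrix algebra is positive if it sends positive semidefinite matrices to positive semidefinite matrices, and completely positive if all its amplifications $\mathrm{id}_n\otimes\Lambda$ are positive.
   Formalization: The claims that Λ is not completely positive are stated only for γ ≠ 0, since at γ = 0 the map Λ(X) = (X + σ₃Xσ₃)/2 deletes the off-diagonal entries and is completely positive. *)

theory Defs
  imports Complex_Main "Jordan_Normal_Form.VS_Connect" "Jordan_Normal_Form.Conjugate"
begin

text \<open>The algebra of complex $d \times d$ matrices is \<open>carrier_mat d d\<close>.\<close>

abbreviation linear_mat_map :: "nat \<Rightarrow> (complex mat \<Rightarrow> complex mat) \<Rightarrow> bool" where
  "linear_mat_map d L \<equiv>
     linear_map class_ring (module_mat TYPE(complex) d d) (module_mat TYPE(complex) d d) L"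

text \<open>In the order on \<^typ>\<open>complex\<close>, \<open>0 \<le> z\<close> means that \<open>z\<close> is real and nonnegative; so the
  condition below forces \<open>A\<close> to be Hermitian. The product \<open>u \<bullet>c v\<close> is
  conjugate-linear in \<open>v\<close>.\<close>

definition psd_mat :: "nat \<Rightarrow> complex mat \<Rightarrow> bool" where
  "psd_mat d A \<longleftrightarrow> A \<in> carrier_mat d d \<and> (\<forall>v \<in> carrier_vec d. 0 \<le> (A *\<^sub>v v) \<bullet>c v)"

text \<open>Linearity is not part of the next two predicates: it is always stated separately, so that
  their negations do not hold merely because linearity fails.\<close>

definition positive_map :: "nat \<Rightarrow> (complex mat \<Rightarrow> complex mat) \<Rightarrow> bool" where
  "positive_map d L \<longleftrightarrow> (\<forall>A. psd_mat d A \<longrightarrow> psd_mat d (L A))"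

definition mat_block :: "nat \<Rightarrow> complex mat \<Rightarrow> nat \<Rightarrow> nat \<Rightarrow> complex mat" where
  "mat_block d A i j = mat d d (\<lambda>(k, l). A $$ (i * d + k, j * d + l))"

text \<open>The map $\mathrm{id}_n \otimes L$, under the usual identification of the tensor product of
  the $n \times n$ and the $d \times d$ matrices with the $nd \times nd$ matrices, seen as
  $n \times n$ arrays of $d \times d$ blocks (Kronecker product): $L$ is applied to each block.
  Lemma \<open>amplification_kronecker\<close> is the defining property on elementary tensors.\<close>

definition amplification ::
  "nat \<Rightarrow> nat \<Rightarrow> (complex mat \<Rightarrow> complex mat) \<Rightarrow> complex mat \<Rightarrow> complex mat" where
  "amplification n d L A = mat (n * d) (n * d)
     (\<lambda>(r, c). L (mat_block d A (r div d) (c div d)) $$ (r mod d, c mod d))"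

definition completely_positive :: "nat \<Rightarrow> (complex mat \<Rightarrow> complex mat) \<Rightarrow> bool" where
  "completely_positive d L \<longleftrightarrow> (\<forall>n. positive_map (n * d) (amplification n d L))"

definition kronecker :: "nat \<Rightarrow> nat \<Rightarrow> complex mat \<Rightarrow> complex mat \<Rightarrow> complex mat" where
  "kronecker n d B X = mat (n * d) (n * d)
     (\<lambda>(r, c). B $$ (r div d, c div d) * X $$ (r mod d, c mod d))"

lemma amplification_kronecker:
  assumes L: "linear_mat_map d L" and X: "X \<in> carrier_mat d d"
  shows "amplification n d L (kronecker n d B X) = kronecker n d B (L X)"
proof (rule eq_matI)
  interpret linear_map class_ring "module_mat TYPE(complex) d d" "module_mat TYPE(complex) d d" L
    by (rule L)
  have smult: "L (a \<cdot>\<^sub>m X) = a \<cdot>\<^sub>m L X" for a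
    using f_smult[of a X] X by (simp add: module_mat_simps class_ring_simps)
  have LX: "L X \<in> carrier_mat d d"
    using f_hom X by (auto simp: LinearCombinations.module_hom_def module_mat_simps)
  fix r c assume "r < dim_row (kronecker n d B (L X))" "c < dim_col (kronecker n d B (L X))"
  then have r: "r < n * d" and c: "c < n * d" by (auto simp: kronecker_def)
  then have d: "d > 0" by (cases d) auto
  have div: "r div d < n" "c div d < n" using r c by (auto simp: less_mult_imp_div_less)
  have bound: "i * d + k < n * d" if "i < n" "k < d" for i k
  proof -
    have "i * d + k < Suc i * d" using that by simp
    also have "\<dots> \<le> n * d" using that by (intro mult_le_mono1) simp
    finally show ?thesis .
  qed
  have "mat_block d (kronecker n d B X) (r div d) (c div d) = B $$ (r div d, c div d) \<cdot>\<^sub>m X"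
    using X div d by (intro eq_matI) (auto simp: mat_block_def kronecker_def bound)
  then show "amplification n d L (kronecker n d B X) $$ (r, c) = kronecker n d B (L X) $$ (r, c)"
    using r c d LX by (simp add: amplification_def kronecker_def smult)
qed (auto simp: amplification_def kronecker_def)

definition pauli1 :: "complex mat" where
  "pauli1 = mat_of_rows_list 2 [[0, 1], [1, 0]]"

definition pauli2 :: "complex mat" where
  "pauli2 = mat_of_rows_list 2 [[0, - \<i>], [\<i>, 0]]"

definition pauli3 :: "complex mat" where
  "pauli3 = mat_of_rows_list 2 [[1, 0], [0, - 1]]"

definition dissipator :: "complex mat \<Rightarrow> complex mat \<Rightarrow> complex mat" where
  "dissipator S X = S * X * S - (1/2) \<cdot>\<^sub>m (S * S * X) - (1/2) \<cdot>\<^sub>m (X * S * S)"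

definition pauli_map :: "real \<Rightarrow> complex mat \<Rightarrow> complex mat" where
  "pauli_map \<gamma> X = X + complex_of_real \<gamma> \<cdot>\<^sub>m dissipator pauli1 X
     - complex_of_real \<gamma> \<cdot>\<^sub>m dissipator pauli2 X + (1/2) \<cdot>\<^sub>m dissipator pauli3 X"

text \<open>At $\gamma = 0$ the map deletes the off-diagonal entries, and this pinching is completely
  positive. Failure of complete positivity can therefore only be claimed for $\gamma \neq 0$.\<close>

lemma pauli_map_0_entry:
  assumes X: "X \<in> carrier_mat 2 2" and k: "k < 2" and l: "l < 2"
  shows "pauli_map 0 X $$ (k, l) = (if k = l then X $$ (k, l) else 0)"
proof -
  have kl: "k = 0 \<or> k = 1" "l = 0 \<or> l = 1" using k l by auto
  show ?thesis using X kl
    by (auto simp: pauli_map_def dissipator_def pauli1_def pauli2_def pauli3_def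
        mat_of_rows_list_def scalar_prod_def numeral_2_eq_2)
qed

lemma completely_positive_pauli_map_0: "completely_positive 2 (pauli_map 0)"
  unfolding completely_positive_def positive_map_def
proof (intro allI impI)
  fix n A assume "psd_mat (n * 2) A"
  define N where "N = n * 2"
  define A' where "A' = amplification n 2 (pauli_map 0) A"
  define s :: "nat \<Rightarrow> complex" where "s r = (if even r then 1 else - 1)" for r
  from \<open>psd_mat (n * 2) A\<close> have A: "A \<in> carrier_mat N N"
    and psd: "\<And>v. v \<in> carrier_vec N \<Longrightarrow> 0 \<le> (A *\<^sub>v v) \<bullet>c v"
    by (auto simp: psd_mat_def N_def)
  have A': "A' \<in> carrier_mat N N" by (simp add: A'_def amplification_def N_def)
  have form: "(M *\<^sub>v v) \<bullet>c v = (\<Sum>r<N. \<Sum>c<N. M $$ (r, c) * v $ c * cnj (v $ r))"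
    if "M \<in> carrier_mat N N" "v \<in> carrier_vec N" for M v
    using that by (auto simp: scalar_prod_def sum_distrib_right atLeast0LessThan intro!: sum.cong)
  have entry: "A' $$ (r, c) = (A $$ (r, c) + s r * A $$ (r, c) * s c) / 2"
    if "r < N" "c < N" for r c
  proof -
    have "A' $$ (r, c) = (if r mod 2 = c mod 2 then A $$ (r, c) else 0)"
      using that div_mult_mod_eq[of r 2]
      by (cases "r mod 2 = c mod 2")
        (simp_all add: A'_def amplification_def N_def pauli_map_0_entry mat_block_def)
    then show ?thesis by (auto simp: s_def even_iff_mod_2_eq_zero odd_iff_mod_2_eq_one)
  qed
  have "0 \<le> (A' *\<^sub>v v) \<bullet>c v" if v: "v \<in> carrier_vec N" for v
  proof -
    define w where "w = vec N (\<lambda>r. s r * v $ r)"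
    have w: "w \<in> carrier_vec N" by (simp add: w_def)
    have "(A' *\<^sub>v v) \<bullet>c v = (\<Sum>r<N. \<Sum>c<N. A $$ (r, c) * v $ c * cnj (v $ r) / 2
        + A $$ (r, c) * w $ c * cnj (w $ r) / 2)"
      unfolding form[OF A' v]
      by (intro sum.cong refl) (auto simp: entry w_def s_def field_simps)
    also have "\<dots> = ((A *\<^sub>v v) \<bullet>c v + (A *\<^sub>v w) \<bullet>c w) / 2"
      unfolding form[OF A v] form[OF A w] by (simp add: sum.distrib sum_divide_distrib add_divide_distrib)
    finally have eq: "(A' *\<^sub>v v) \<bullet>c v = ((A *\<^sub>v v) \<bullet>c v + (A *\<^sub>v w) \<bullet>c w) / 2" .
    show ?thesis unfolding eq using psd[OF v] psd[OF w] by (auto simp: less_eq_complex_def)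
  qed
  with A' show "psd_mat (n * 2) (amplification n 2 (pauli_map 0) A)"
    by (simp add: psd_mat_def A'_def N_def)
qed

end

(* Write Z = diag(1, -1) and t = 2 * \<gamma>. Then \<Lambda>(X) = (1 + t)/2 * X^T + (1 - t)/2 * Z X^T Z, a convex
   combination of two positive maps when -1 \<le> t \<le> 1. On the unnormalised maximally entangled
   projection on C^2 \<otimes> C^2, the amplification has the block [[0, t], [t, 0]] on the span of
   e_1 \<otimes> e_2 and e_2 \<otimes> e_1, which has the eigenvalue -\<bar>t\<bar>. *)

theory Submission
  imports Defs
begin

lemma pauli_map_carrier:
  assumes "X \<in> carrier_mat 2 2"
  shows "pauli_map \<gamma> X \<in> carrier_mat 2 2"
  using assms
  by (auto simp: pauli_map_def dissipator_def pauli1_def pauli2_def pauli3_def mat_of_rows_list_def)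

text \<open>Since each Pauli matrix squares to 1, \<open>dissipator S X\<close> is
  \<open>S * X * S - X\<close>. Conjugations by \<open>pauli1\<close> and \<open>pauli2\<close>
  agree on the diagonal and have opposite signs off it, so their difference is twice the swapped
  off-diagonal part; the \<open>pauli3\<close> term removes the original one.\<close>

lemma pauli_map_entry:
  assumes X: "X \<in> carrier_mat 2 2" and "k < 2" "l < 2"
  shows "pauli_map \<gamma> X $$ (k, l) =
    (if k = l then X $$ (k, l) else 2 * complex_of_real \<gamma> * X $$ (l, k))"
proof -
  have "k = 0 \<or> k = 1" "l = 0 \<or> l = 1" using assms by auto
  then show ?thesis using X
    by (auto simp: pauli_map_def dissipator_def pauli1_def pauli2_def pauli3_def
        mat_of_rows_list_def scalar_prod_def numeral_2_eq_2 algebra_simps)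
qed

lemma pauli_map_eqI:
  assumes "X \<in> carrier_mat 2 2" "Y \<in> carrier_mat 2 2"
    and "\<And>k l. k < 2 \<Longrightarrow> l < 2 \<Longrightarrow>
      Y $$ (k, l) = (if k = l then X $$ (k, l) else 2 * complex_of_real \<gamma> * X $$ (l, k))"
  shows "pauli_map \<gamma> X = Y"
  using assms pauli_map_carrier[OF assms(1), of \<gamma>] by (intro eq_matI) (auto simp: pauli_map_entry)

lemma linear_pauli_map: "linear_mat_map 2 (pauli_map \<gamma>)"
proof -
  interpret M: vectorspace class_ring "module_mat TYPE(complex) 2 2"
    by (rule matrix_vs)
  have add: "pauli_map \<gamma> (X + Y) = pauli_map \<gamma> X + pauli_map \<gamma> Y"
    if X: "X \<in> carrier_mat 2 2" and Y: "Y \<in> carrier_mat 2 2" for X Y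
    using X Y carrier_matD[OF pauli_map_carrier[OF X]] carrier_matD[OF pauli_map_carrier[OF Y]]
    by (intro pauli_map_eqI) (auto simp: pauli_map_entry algebra_simps intro: pauli_map_carrier)
  have smult: "pauli_map \<gamma> (a \<cdot>\<^sub>m X) = a \<cdot>\<^sub>m pauli_map \<gamma> X" if X: "X \<in> carrier_mat 2 2" for a X
    using X carrier_matD[OF pauli_map_carrier[OF X]]
    by (intro pauli_map_eqI) (auto simp: pauli_map_entry intro: pauli_map_carrier)
  have "pauli_map \<gamma> \<in> LinearCombinations.module_hom class_ring
      (module_mat TYPE(complex) 2 2) (module_mat TYPE(complex) 2 2)"
    by (simp add: LinearCombinations.module_hom_def module_mat_simps pauli_map_carrier add smult)
  then show ?thesis
    by (intro linear_map.intro mod_hom.intro mod_hom_axioms.intro M.vectorspace_axioms M.module_axioms)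
qed

lemma pauli_map_matrix:
  "pauli_map \<gamma> (mat_of_rows_list 2 [[r11, r12], [r21, r22]]) =
     mat_of_rows_list 2 [[r11, 2 * complex_of_real \<gamma> * r21], [2 * complex_of_real \<gamma> * r12, r22]]"
  by (rule pauli_map_eqI) (auto simp: mat_of_rows_list_def less_2_cases_iff)

lemma pauli_map_half_eq_transpose:
  "X \<in> carrier_mat 2 2 \<Longrightarrow> pauli_map (1/2) X = transpose_mat X"
  by (rule pauli_map_eqI) auto

lemma quadratic_form_eq_sum:
  assumes "M \<in> carrier_mat N N" "v \<in> carrier_vec N"
  shows "(M *\<^sub>v v) \<bullet>c v = (\<Sum>r<N. \<Sum>c<N. M $$ (r, c) * v $ c * cnj (v $ r))"
  using assms by (auto simp: scalar_prod_def sum_distrib_right atLeast0LessThan intro!: sum.cong)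

lemma positive_pauli_map:
  assumes "- 1/2 \<le> \<gamma>" "\<gamma> \<le> 1/2"
  shows "positive_map 2 (pauli_map \<gamma>)"
  unfolding positive_map_def
proof (intro allI impI)
  fix A assume "psd_mat 2 A"
  then have A: "A \<in> carrier_mat 2 2"
    and psd: "\<And>v. v \<in> carrier_vec 2 \<Longrightarrow> 0 \<le> (A *\<^sub>v v) \<bullet>c v"
    by (auto simp: psd_mat_def)
  note LA = pauli_map_carrier[OF A, of \<gamma>]
  have "0 \<le> (pauli_map \<gamma> A *\<^sub>v v) \<bullet>c v" if v: "v \<in> carrier_vec 2" for v
  proof -
    \<comment> \<open>The form of \<open>A\<^sup>T\<close> at \<open>v\<close> is the form of \<open>A\<close> at the complex conjugate of \<open>v\<close>.\<close>
    define w where "w s = vec 2 (\<lambda>r. if r = 0 then cnj (v $ r) else s * cnj (v $ r))" for s :: complex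
    have w: "w s \<in> carrier_vec 2" for s by (simp add: w_def)
    \<comment> \<open>The diagonal terms are the same at \<open>w 1\<close> and
      \<open>w (- 1)\<close>, and the weights sum to 1; the off-diagonal terms change sign, so they
      are scaled by the difference 2 * \<gamma> of the weights.\<close>
    have eq: "(pauli_map \<gamma> A *\<^sub>v v) \<bullet>c v =
        complex_of_real (1/2 + \<gamma>) * ((A *\<^sub>v w 1) \<bullet>c w 1)
        + complex_of_real (1/2 - \<gamma>) * ((A *\<^sub>v w (- 1)) \<bullet>c w (- 1))"
      unfolding quadratic_form_eq_sum[OF LA v] quadratic_form_eq_sum[OF A w]
      by (simp add: numeral_2_eq_2 pauli_map_entry[OF A, unfolded numeral_2_eq_2] w_def)
        (simp add: field_simps)
    \<comment> \<open>The range of \<gamma> is exactly what makes both weights nonnegative.\<close>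
    have "0 \<le> complex_of_real (1/2 + \<gamma>)" "0 \<le> complex_of_real (1/2 - \<gamma>)"
      using assms by (simp_all add: less_eq_complex_def)
    with psd[OF w] show ?thesis unfolding eq
      by (auto simp: less_eq_complex_def)
  qed
  with LA show "psd_mat 2 (pauli_map \<gamma> A)" by (simp add: psd_mat_def)
qed

text \<open>The amplification with n = 2 already fails: a Hermitian 2 x 2 block with zero diagonal
  and nonzero off-diagonal entries has negative determinant.\<close>

lemma not_completely_positive_pauli_map:
  assumes "\<gamma> \<noteq> 0"
  shows "\<not> completely_positive 2 (pauli_map \<gamma>)"
proof
  assume cp: "completely_positive 2 (pauli_map \<gamma>)"
  \<comment> \<open>Row 2 * i + k stands for the tensor of the basis vectors i and k, so 0 and 3 are
    the two diagonal tensors and \<open>A\<close> is the rank-one matrix of their sum.\<close>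
  define A :: "complex mat" where
    "A = mat 4 4 (\<lambda>(r, c). if (r = 0 \<or> r = 3) \<and> (c = 0 \<or> c = 3) then 1 else 0)"
  define B where "B = amplification 2 2 (pauli_map \<gamma>) A"
  have A: "A \<in> carrier_mat 4 4" and B: "B \<in> carrier_mat 4 4"
    by (simp_all add: A_def B_def amplification_def)
  have "0 \<le> (A *\<^sub>v v) \<bullet>c v" if v: "v \<in> carrier_vec 4" for v
  proof -
    have "(A *\<^sub>v v) \<bullet>c v = (v $ 0 + v $ 3) * cnj (v $ 0 + v $ 3)"
      unfolding quadratic_form_eq_sum[OF A v]
      by (simp add: A_def eval_nat_numeral algebra_simps)
    also have "\<dots> = complex_of_real ((cmod (v $ 0 + v $ 3))\<^sup>2)"
      by (rule complex_norm_square[symmetric])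
    finally show ?thesis by (simp add: less_eq_complex_def)
  qed
  with A have "psd_mat (2 * 2) A" by (simp add: psd_mat_def)
  with cp have "psd_mat (2 * 2) B"
    unfolding completely_positive_def positive_map_def B_def by blast
  then have B_psd: "0 \<le> (B *\<^sub>v v) \<bullet>c v" if "v \<in> carrier_vec 4" for v
    using that by (simp add: psd_mat_def)
  \<comment> \<open>The factor -\<gamma> makes the two cross terms add up to -4 * \<gamma>^2,
    negative for either sign of \<gamma>; an eigenvector would require a case split.\<close>
  define v where "v = vec_of_list [0, 1, - complex_of_real \<gamma>, 0]"
  have v: "v \<in> carrier_vec 4" unfolding v_def by (intro carrier_vecI) simp
  \<comment> \<open>Block (0, 1) of \<open>A\<close> has its single 1 at (0, 1), which the map moves
    to (1, 0) with factor 2 * \<gamma>; this is position (1, 2) of \<open>B\<close>.\<close>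
  have B_entries: "B $$ (1, 1) = 0" "B $$ (2, 2) = 0"
    "B $$ (1, 2) = 2 * complex_of_real \<gamma>" "B $$ (2, 1) = 2 * complex_of_real \<gamma>"
    by (simp_all add: B_def amplification_def mat_block_def pauli_map_entry A_def)
  have v_entries: "v $ 0 = 0" "v $ 1 = 1" "v $ 2 = - complex_of_real \<gamma>" "v $ 3 = 0"
    by (simp_all add: v_def numeral_2_eq_2 numeral_3_eq_3)
  have "{..<4::nat} = {0, 1, 2, 3}" by auto
  then have "(B *\<^sub>v v) \<bullet>c v = complex_of_real (- 4 * \<gamma>\<^sup>2)"
    unfolding quadratic_form_eq_sum[OF B v]
    by (simp add: v_entries B_entries v_entries[unfolded One_nat_def] B_entries[unfolded One_nat_def]
        power2_eq_square)
  with B_psd[OF v] assms show False by (simp add: less_eq_complex_def)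
qed

text \<open>The claims against complete positivity leave out \<gamma> = 0 because of
  \<open>completely_positive_pauli_map_0\<close>.\<close>

theorem mainTheorem4:
  shows "(\<forall>\<gamma>::real. linear_mat_map 2 (pauli_map \<gamma>)) \<and>
    (\<forall>(\<gamma>::real) (r11::complex) r12 r21 r22.
       pauli_map \<gamma> (mat_of_rows_list 2 [[r11, r12], [r21, r22]]) =
       mat_of_rows_list 2 [[r11, 2 * complex_of_real \<gamma> * r21],
                           [2 * complex_of_real \<gamma> * r12, r22]]) \<and>
    (\<forall>X \<in> carrier_mat 2 2. pauli_map (1/2) X = transpose_mat X) \<and>
    (\<forall>\<gamma>::real. - 1/2 \<le> \<gamma> \<and> \<gamma> \<le> 1/2 \<longrightarrow> positive_map 2 (pauli_map \<gamma>)) \<and>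
    (\<forall>\<gamma>::real. \<gamma> \<noteq> 0 \<longrightarrow> \<not> completely_positive 2 (pauli_map \<gamma>)) \<and>
    (\<forall>\<gamma>::real. - 1/2 \<le> \<gamma> \<and> \<gamma> \<le> 1/2 \<and> \<gamma> \<noteq> 0 \<longrightarrow>
       positive_map 2 (pauli_map \<gamma>) \<and> \<not> completely_positive 2 (pauli_map \<gamma>))"
  by (intro conjI allI ballI impI)
    (simp_all add: linear_pauli_map pauli_map_matrix pauli_map_half_eq_transpose positive_pauli_map
      not_completely_positive_pauli_map)

end
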